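(* Let $n\ge 2$, let $q=(q_1,\dots,q_n)$ with all $q_i>0$, and let $$\|q\|_{\mathbb{R}}=\frac1n\cdot\frac{V_{n-1}(\partial E_q)}{V_n(E_q)}=⨍_{\mathbb{S}^{n-1}}\sqrt{\sum_{i=1}^n q_i^2x_i^2}\;d\sigma(x),\qquad \|q\|=\Bigl(\sum_{i=1}^n q_i^2\Bigr)^{1/2}.$$ Then $$\frac{3\,\Gamma\left(\frac n2\right)}{2\,\Gamma\left(\frac{n+1}2\right)}\ \ge\ \frac{\|q\|_{\mathbb{R}}}{\|q\|}\ \ge\ \frac{\Gamma\left(\frac n2\right)}{\sqrt{\pi}\,\Gamma\left(\frac{n+1}2\right)}.$$
   Context: $E_q=\{x\in\mathbb{R}^n : \sum_{i=1}^n q_i^2x_i^2\le 1\}$ is the ellipsoid with semi-axes $1/q_1,\dots,1/q_n$; $V_n(E_q)$ is its volume and $V_{n-1}(\partial E_q)$ its surface area. $\mathbb{S}^{n-1}$ is the unit sphere in $\mathbb{R}^n$, $\sigma$ its standard area measure, and $⨍_{\mathbb{S}^{n-1}} f\,d\sigma=\frac{1}{\sigma(\mathbb{S}^{n-1})}\int_{\mathbb{S}^{n-1}} f\,d\sigma$. The equality of the two expressions for $\|q\|_{\mathbb{R}}$ follows from Cauchy's projection formula. *)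

theory Defs
  imports "HOL-Analysis.Analysis"
begin

definition ellipsoid :: "real ^ 'n \<Rightarrow> (real ^ 'n) set" where
  "ellipsoid q = {x. (\<Sum>i\<in>UNIV. (q $ i)\<^sup>2 * (x $ i)\<^sup>2) \<le> 1}"

text \<open>
  Area of a hypersurface as its codimension-one Minkowski content: the volume of the
  \<open>\<epsilon>\<close>-tube around the set, divided by the length \<open>2\<epsilon>\<close> of the normal
  segment, as \<open>\<epsilon>\<close> tends to 0 from above. For compact smooth hypersurfaces the limit exists and
  is the usual (equivalently, the suitably normalized Hausdorff) surface area. If the limit does
  not exist, \<open>Lim\<close> is an unspecified value.
\<close>

definition surface_area :: "'a::euclidean_space set \<Rightarrow> real" where
  "surface_area A =
     Lim (at_right 0) (\<lambda>\<epsilon>. measure lborel {x. infdist x A \<le> \<epsilon>} / (2 * \<epsilon>))"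

text \<open>
  The area measure on the unit sphere, from polar coordinates: the area of a Borel set \<open>A\<close>
  of unit vectors is \<open>n\<close> times the volume of the cone of all \<open>t *\<^sub>R x\<close> with
  \<open>0 < t \<le> 1\<close> and \<open>x\<close> in \<open>A\<close>. Here \<open>sgn x\<close> is \<open>x /\<^sub>R norm x\<close>.
\<close>

definition sphere_measure :: "'a::euclidean_space measure" where
  "sphere_measure =
     scale_measure (of_nat DIM('a))
       (distr (restrict_space lborel (cball 0 1 - {0})) (restrict_space borel (sphere 0 1)) sgn)"

lemma sgn_measurable_sphere:
  "(sgn :: 'a::euclidean_space \<Rightarrow> 'a)
     \<in> restrict_space lborel (cball 0 1 - {0}) \<rightarrow>\<^sub>M restrict_space borel (sphere 0 1)"
proof -
  have "(\<lambda>x. x /\<^sub>R norm x) \<in> borel_measurable (borel :: 'a measure)"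
    by measurable
  then have "(sgn :: 'a \<Rightarrow> 'a) \<in> borel_measurable borel"
    by (simp add: sgn_div_norm[abs_def])
  then show ?thesis
    by (intro measurable_restrict_space2 measurable_restrict_space1)
       (auto simp: space_restrict_space norm_sgn)
qed

lemma space_sphere_measure [simp]: "space (sphere_measure :: 'a::euclidean_space measure) = sphere 0 1"
  by (simp add: sphere_measure_def space_scale_measure space_restrict_space)

lemma emeasure_sphere_measure:
  fixes A :: "'a::euclidean_space set"
  assumes A: "A \<in> sets borel" "A \<subseteq> sphere 0 1"
  shows "emeasure sphere_measure A
       = of_nat DIM('a) * emeasure lborel {t *\<^sub>R x |t x. 0 < t \<and> t \<le> 1 \<and> x \<in> A}"
proof -
  have sA: "A \<in> sets (restrict_space borel (sphere 0 1))"
    using A by (auto simp: sets_restrict_space_iff)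
  have eq: "sgn -` A \<inter> space (restrict_space lborel (cball 0 1 - {0}))
      = {t *\<^sub>R x |t x. 0 < t \<and> t \<le> 1 \<and> x \<in> A}" (is "?L = ?R")
  proof (intro set_eqI iffI)
    fix y assume "y \<in> ?L"
    then have "sgn y \<in> A" "0 < norm y" "norm y \<le> 1" "y = norm y *\<^sub>R sgn y"
      by (auto simp: space_restrict_space sgn_div_norm)
    then show "y \<in> ?R" by blast
  next
    fix y assume "y \<in> ?R"
    then obtain t x where y: "y = t *\<^sub>R x" "0 < t" "t \<le> 1" "x \<in> A" by blast
    with A have "norm x = 1" by auto
    with y show "y \<in> ?L"
      by (auto simp: space_restrict_space sgn_div_norm)
  qed
  have "?R \<subseteq> cball 0 1 - {0}"
    unfolding eq[symmetric] by (auto simp: space_restrict_space)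
  then show ?thesis
    unfolding sphere_measure_def emeasure_scale_measure
    by (subst emeasure_distr[OF sgn_measurable_sphere sA], unfold eq,
        subst emeasure_restrict_space) auto
qed

definition sphere_average :: "('a::euclidean_space \<Rightarrow> real) \<Rightarrow> real" where
  "sphere_average f =
     1 / measure sphere_measure (sphere 0 1 :: 'a set) * (\<integral>x. f x \<partial>sphere_measure)"

definition norm_R :: "real ^ 'n \<Rightarrow> real" where
  "norm_R q = 1 / real CARD('n) *
     (surface_area (frontier (ellipsoid q)) / measure lborel (ellipsoid q))"

end

theory Submission
  imports Defs "HOL-Probability.Distributions"
begin

text \<open>
  Let \<open>h x\<close> be the square root of \<open>\<Sum>i\<in>UNIV. (q $ i)\<^sup>2 * (x $ i)\<^sup>2\<close>, that is, the norm of \<open>D x\<close> for the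
  diagonal matrix \<open>D\<close> with entries \<open>q\<close>. Everything is reduced to integrals over the sphere by polar
  coordinates (\<open>nn_integral_polar\<close>), which hold for the cone definition of the area measure because
  volume scales with the \<open>n\<close>-th power of the radius.

  The equality of the two expressions is a first variation of volume. The linear map that takes
  the unit ball to the ellipsoid takes the set \<open>S + \<epsilon> K\<close> to the tube of radius \<open>\<epsilon>\<close> around the boundary
  of the ellipsoid, where \<open>S\<close> is the unit sphere and \<open>K\<close> the image of the unit ball under \<open>D\<close>; its
  determinant cancels in the ratio of area to volume. In a direction \<open>u\<close> the set \<open>S + \<epsilon> K\<close> occupies
  the radii from \<open>1 - \<epsilon> * h u\<close> to \<open>1 + \<epsilon> * h u\<close> up to errors of order \<open>\<epsilon>\<^sup>2\<close> that are uniform in \<open>u\<close>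
  (\<open>nbhd_outer\<close>, \<open>nbhd_inner\<close>), because \<open>h\<close> is the support function of \<open>K\<close>. So its volume divided by
  \<open>2 * \<epsilon>\<close> tends to the integral of \<open>h\<close> over the sphere (\<open>tendsto_measure_nbhd\<close>).

  For the bounds, let \<open>X\<close> be a random vector with density proportional to \<open>exp (- (norm x)\<^sup>2)\<close>. As \<open>h\<close> is
  homogeneous, its mean over the sphere is \<open>Gamma (n / 2) / Gamma ((n + 1) / 2)\<close> times the mean of
  \<open>h X\<close> (\<open>sphere_average_gaussian\<close>). The coordinates of \<open>X\<close> are independent with second moment \<open>1 / 2\<close>
  and first absolute moment \<open>1 / sqrt pi\<close>. So the mean of \<open>h X\<close> is at most \<open>norm q / sqrt 2\<close>, the root
  of the mean of the square, and by the Cauchy-Schwarz inequality at least \<open>norm q / sqrt pi\<close>. The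
  upper bound follows because \<open>1 / sqrt 2 \<le> 3 / 2\<close>.
\<close>

section \<open>Polar coordinates\<close>

text \<open>
  The radial factor of volume in polar coordinates, as a measure on the whole line that charges
  only the positive half.
\<close>
definition radial_measure :: "nat \<Rightarrow> real measure" where
  "radial_measure n = density lborel (\<lambda>r. ennreal (r ^ (n - 1)) * indicator {0<..} r)"

lemma sets_radial_measure [simp, measurable_cong]: "sets (radial_measure n) = sets borel"
  by (simp add: radial_measure_def)

lemma space_radial_measure [simp]: "space (radial_measure n) = UNIV"
  by (simp add: radial_measure_def)

lemma sets_sphere_measure [simp, measurable_cong]:
  "sets (sphere_measure :: 'a::euclidean_space measure) = sets (restrict_space borel (sphere 0 1))"
  by (simp add: sphere_measure_def)

lemma emeasure_radial_measure_atMost: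
  assumes "n > 0" "\<rho> \<ge> 0"
  shows "of_nat n * emeasure (radial_measure n) {..\<rho>} = ennreal (\<rho> ^ n)"
proof -
  have "emeasure (radial_measure n) {..\<rho>}
      = (\<integral>\<^sup>+ r. ennreal (r ^ (n - 1)) * indicator {0<..} r * indicator {..\<rho>} r \<partial>lborel)"
    unfolding radial_measure_def by (subst emeasure_density) auto
  also have "\<dots> = (\<integral>\<^sup>+ r. ennreal (r ^ (n - 1)) * indicator {0..\<rho>} r \<partial>lborel)"
    by (intro nn_integral_cong_AE AE_I[of _ _ "{0}"]) (auto simp: indicator_def)
  also have "\<dots> = ennreal (\<rho> ^ n / n - 0 ^ n / n)"
    using assms
    by (intro nn_integral_FTC_Icc[of "\<lambda>r. r ^ (n - 1)" 0 \<rho> "\<lambda>r. r ^ n / n"])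
       (auto intro!: derivative_eq_intros)
  finally have *: "emeasure (radial_measure n) {..\<rho>} = ennreal (\<rho> ^ n / n)"
    using assms by (simp add: zero_power)
  show ?thesis
    using assms unfolding * ennreal_of_nat_eq_real_of_nat by (subst ennreal_mult[symmetric]) auto
qed

lemma emeasure_radial_measure_nonpos:
  assumes "\<rho> \<le> 0"
  shows "emeasure (radial_measure n) {..\<rho>} = 0"
  unfolding radial_measure_def using assms
  by (subst emeasure_density) (auto simp: indicator_def nn_integral_0_iff_AE)

lemma emeasure_radial_measure_atMost_finite: "emeasure (radial_measure n) {..\<rho>} < \<infinity>"
proof -
  have "emeasure (radial_measure n) {..\<rho>}
      = (\<integral>\<^sup>+ r. ennreal (r ^ (n - 1)) * indicator {0<..} r * indicator {..\<rho>} r \<partial>lborel)"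
    unfolding radial_measure_def by (subst emeasure_density) auto
  also have "\<dots> \<le> (\<integral>\<^sup>+ r. ennreal (\<rho> ^ (n - 1)) * indicator {0..\<rho>} r \<partial>lborel)"
    by (intro nn_integral_mono) (auto simp: indicator_def intro!: ennreal_leI power_mono)
  also have "\<dots> < \<infinity>"
    by (subst nn_integral_cmult_indicator) (auto simp: emeasure_lborel_Icc_eq ennreal_mult_less_top)
  finally show ?thesis .
qed

lemma sigma_finite_radial_measure: "sigma_finite_measure (radial_measure n)"
proof
  show "\<exists>A. countable A \<and> A \<subseteq> sets (radial_measure n) \<and> \<Union>A = space (radial_measure n)
      \<and> (\<forall>a\<in>A. emeasure (radial_measure n) a \<noteq> \<infinity>)"
  proof (intro exI[of _ "range (\<lambda>i. {..real i})"] conjI ballI)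
    show "\<Union> (range (\<lambda>i. {..real i})) = space (radial_measure n)"
      using real_arch_simple by auto
    fix a assume "a \<in> range (\<lambda>i. {..real i})"
    then obtain i where "a = {..real i}" by blast
    then show "emeasure (radial_measure n) a \<noteq> \<infinity>"
      using emeasure_radial_measure_atMost_finite[of n "real i"] by (simp add: less_top)
  qed auto
qed

lemma nn_integral_radial_measure:
  assumes [measurable]: "f \<in> borel_measurable borel"
  shows "(\<integral>\<^sup>+ r. f r \<partial>radial_measure n) = (\<integral>\<^sup>+ r. ennreal (r ^ (n - 1)) * indicator {0<..} r * f r \<partial>lborel)"
  unfolding radial_measure_def by (subst nn_integral_density) auto

lemma finite_sphere_measure: "finite_measure (sphere_measure :: 'a::euclidean_space measure)"
proof
  have "emeasure lborel {t *\<^sub>R x |t x. 0 < t \<and> t \<le> 1 \<and> x \<in> sphere (0::'a) 1}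
      \<le> emeasure lborel (cball (0::'a) 1)"
    by (intro emeasure_mono) auto
  also have "\<dots> < \<infinity>" by (rule emeasure_lborel_cball_finite)
  finally show "emeasure (sphere_measure :: 'a measure) (space sphere_measure) \<noteq> \<infinity>"
    by (simp add: emeasure_sphere_measure ennreal_mult_eq_top_iff of_nat_eq_0_iff)
qed

lemma borel_measurable_sphere_measure:
  "f \<in> borel_measurable borel \<Longrightarrow> f \<in> borel_measurable (sphere_measure :: 'a::euclidean_space measure)"
  by (subst measurable_cong_sets[OF sets_sphere_measure refl]) (rule measurable_restrict_space1)

definition sector :: "'a::euclidean_space set \<Rightarrow> 'a set" where
  "sector A = {x. x \<noteq> 0 \<and> sgn x \<in> A}"

lemma sgn_borel_measurable: "(sgn :: 'a::euclidean_space \<Rightarrow> 'a) \<in> borel_measurable borel"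
proof -
  have "(\<lambda>x. x /\<^sub>R norm x) \<in> borel_measurable (borel :: 'a measure)"
    by measurable
  then show ?thesis by (simp add: sgn_div_norm[abs_def])
qed

lemma sector_borel:
  assumes "A \<in> sets borel" shows "sector A \<in> sets (borel :: 'a::euclidean_space measure)"
proof -
  note [measurable] = sgn_borel_measurable assms
  have "sector A = {x \<in> space borel. x \<noteq> 0 \<and> sgn x \<in> A}" by (auto simp: sector_def)
  also have "\<dots> \<in> sets borel" by measurable
  finally show ?thesis .
qed

text \<open>
  The area of \<open>A\<close> is by definition \<open>n\<close> times the volume of the cone over \<open>A\<close> inside the unit ball.
  Dilating by \<open>\<rho>\<close> multiplies this volume by \<open>\<rho> ^ n\<close>, which is \<open>n\<close> times the radial measure of the
  interval up to \<open>\<rho>\<close>.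
\<close>
lemma emeasure_sector_cball:
  fixes A :: "'a::euclidean_space set"
  assumes A: "A \<in> sets borel" "A \<subseteq> sphere 0 1"
  shows "emeasure lborel (sector A \<inter> cball 0 \<rho>) = emeasure sphere_measure A * emeasure (radial_measure DIM('a)) {..\<rho>}"
proof (cases "\<rho> > 0")
  case False
  then have "sector A \<inter> cball 0 \<rho> = {}"
    by (auto simp: sector_def) (metis less_le_trans norm_le_zero_iff not_less order_trans)
  then show ?thesis using False by (simp add: emeasure_radial_measure_nonpos)
next
  case True
  note [measurable] = sector_borel[OF A(1)]
  have cone: "{t *\<^sub>R x |t x. 0 < t \<and> t \<le> 1 \<and> x \<in> A} = sector A \<inter> cball 0 1" (is "?L = _")
  proof (intro set_eqI iffI)
    fix y assume "y \<in> ?L"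
    then obtain t x where y: "y = t *\<^sub>R x" "0 < t" "t \<le> 1" "x \<in> A" by blast
    with A have "norm x = 1" by auto
    with y show "y \<in> sector A \<inter> cball 0 1" by (auto simp: sector_def sgn_div_norm)
  next
    fix y assume "y \<in> sector A \<inter> cball 0 1"
    then have "sgn y \<in> A" "0 < norm y" "norm y \<le> 1" "y = norm y *\<^sub>R sgn y"
      by (auto simp: sector_def sgn_div_norm)
    then show "y \<in> ?L" by blast
  qed
  have "emeasure lborel (sector A \<inter> cball 0 \<rho>)
      = emeasure (density (distr lborel borel (\<lambda>x::'a. 0 + \<rho> *\<^sub>R x)) (\<lambda>_. \<bar>\<rho>\<bar>^DIM('a))) (sector A \<inter> cball 0 \<rho>)"
    using True by (subst lborel_affine[of \<rho> 0]) auto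
  also have "\<dots> = ennreal (\<rho> ^ DIM('a)) * emeasure lborel ((\<lambda>x. \<rho> *\<^sub>R x) -` (sector A \<inter> cball 0 \<rho>))"
    using True
    by (subst emeasure_density, simp, simp, subst nn_integral_cmult_indicator, simp, subst emeasure_distr)
       simp_all
  also have "(\<lambda>x. \<rho> *\<^sub>R x) -` (sector A \<inter> cball 0 \<rho>) = sector A \<inter> cball 0 1"
    using True by (auto simp: sector_def sgn_scaleR)
  also have "ennreal (\<rho> ^ DIM('a)) = of_nat DIM('a) * emeasure (radial_measure DIM('a)) {..\<rho>}"
    using True by (subst emeasure_radial_measure_atMost) auto
  finally show ?thesis
    using A by (simp add: emeasure_sphere_measure cone mult_ac)
qed

text \<open>
  For a fixed set of directions both sides are measures in \<open>B\<close>, so the half-lines treated before suffice.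
\<close>
lemma emeasure_sector_norm:
  fixes A :: "'a::euclidean_space set"
  assumes A: "A \<in> sets borel" "A \<subseteq> sphere 0 1" and B: "B \<in> sets borel"
  shows "emeasure lborel (sector A \<inter> norm -` B) = emeasure sphere_measure A * emeasure (radial_measure DIM('a)) B"
proof -
  interpret S: finite_measure "sphere_measure :: 'a measure" by (rule finite_sphere_measure)
  note [measurable] = sector_borel[OF A(1)]
  define M1 where "M1 = distr (density lborel (indicator (sector A))) borel (norm :: 'a \<Rightarrow> real)"
  define M2 where "M2 = scale_measure (emeasure sphere_measure A) (radial_measure DIM('a))"
  have M1: "emeasure M1 X = emeasure lborel (sector A \<inter> norm -` X)" if [measurable]: "X \<in> sets borel" for X
  proof -
    have [measurable]: "norm -` X \<in> sets (borel :: 'a measure)"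
      using measurable_sets[OF borel_measurable_continuous_onI[OF continuous_on_norm_id] that] by simp
    show ?thesis
      by (simp add: M1_def emeasure_distr emeasure_density Int_commute flip: indicator_inter_arith)
  qed
  have "M1 = M2"
  proof (rule measure_eqI_generator_eq[of "range atMost" UNIV _ _ "\<lambda>i. {..real i}"])
    show "Int_stable (range atMost :: real set set)"
      by (auto simp: Int_stable_def)
    show "sets M1 = sigma_sets UNIV (range atMost)" "sets M2 = sigma_sets UNIV (range atMost)"
      by (simp_all add: M1_def M2_def borel_eq_atMost)
    have eq: "emeasure M1 {..\<rho>} = emeasure M2 {..\<rho>}" for \<rho>
    proof -
      have "emeasure M1 {..\<rho>} = emeasure lborel (sector A \<inter> cball 0 \<rho>)"
        by (subst M1) (auto intro!: arg_cong[where f="emeasure lborel"])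
      then show ?thesis using A by (simp add: emeasure_sector_cball M2_def)
    qed
    show "emeasure M1 X = emeasure M2 X" if "X \<in> range atMost" for X using that eq by auto
    show "(\<Union>i. {..real i}) = UNIV" using real_arch_simple by auto
    show "emeasure M1 {..real i} \<noteq> \<infinity>" for i
      unfolding eq using emeasure_radial_measure_atMost_finite[of "DIM('a)" "real i"]
      by (simp add: M2_def ennreal_mult_eq_top_iff less_top)
  qed auto
  then show ?thesis using M1[OF B] by (simp add: M2_def)
qed


text \<open>
  Away from the origin, \<open>x \<mapsto> (sgn x, norm x)\<close> pushes volume forward to the product of the area measure
  and \<open>r ^ (n - 1) dr\<close>: two \<open>\<sigma>\<close>-finite measures that agree on rectangles.
\<close>
theorem nn_integral_polar:
  fixes F :: "'a::euclidean_space \<Rightarrow> ennreal"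
  assumes [measurable]: "F \<in> borel_measurable borel"
  shows "(\<integral>\<^sup>+ x. F x \<partial>lborel)
    = (\<integral>\<^sup>+ u. (\<integral>\<^sup>+ r. F (r *\<^sub>R u) \<partial>radial_measure DIM('a)) \<partial>sphere_measure)"
proof -
  let ?S = "sphere_measure :: 'a measure" and ?N = "radial_measure DIM('a)"
  let ?L = "restrict_space lborel (- {0::'a})"
  interpret N: sigma_finite_measure ?N by (rule sigma_finite_radial_measure)
  have sgn_S: "sgn \<in> ?L \<rightarrow>\<^sub>M ?S"
  proof (subst measurable_cong_sets[OF refl sets_sphere_measure], rule measurable_restrict_space2)
    show "sgn \<in> space ?L \<rightarrow> sphere 0 1"
      by (auto simp: space_restrict_space norm_sgn)
    show "sgn \<in> ?L \<rightarrow>\<^sub>M borel"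
      using sgn_borel_measurable by (auto intro!: measurable_restrict_space1)
  qed
  have P: "(\<lambda>x. (sgn x, norm x)) \<in> ?L \<rightarrow>\<^sub>M ?S \<Otimes>\<^sub>M ?N"
    using sgn_S
    by (intro measurable_Pair) (auto intro!: measurable_restrict_space1)
  have eq: "?S \<Otimes>\<^sub>M ?N = distr ?L (?S \<Otimes>\<^sub>M ?N) (\<lambda>x. (sgn x, norm x))"
  proof (rule pair_measure_eqI)
    show "sigma_finite_measure ?S"
      using finite_sphere_measure by (rule finite_measure.axioms)
    fix A B assume AB: "A \<in> sets ?S" "B \<in> sets ?N"
    then have A: "A \<in> sets borel" "A \<subseteq> sphere 0 1" and B: "B \<in> sets borel"
      by (auto simp: sets_restrict_space_iff)
    have "emeasure (distr ?L (?S \<Otimes>\<^sub>M ?N) (\<lambda>x. (sgn x, norm x))) (A \<times> B)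
        = emeasure ?L (sector A \<inter> norm -` B)"
      using AB P by (subst emeasure_distr)
        (auto intro!: arg_cong[where f="emeasure ?L"] simp: sector_def space_restrict_space)
    also have "\<dots> = emeasure lborel (sector A \<inter> norm -` B)"
      by (subst emeasure_restrict_space) (auto simp: sector_def)
    finally show "emeasure ?S A * emeasure ?N B
        = emeasure (distr ?L (?S \<Otimes>\<^sub>M ?N) (\<lambda>x. (sgn x, norm x))) (A \<times> B)"
      using emeasure_sector_norm[OF A B] by simp
  qed (simp_all add: sigma_finite_radial_measure)
  have id_S: "(\<lambda>u::'a. u) \<in> ?S \<rightarrow>\<^sub>M borel"
    by (subst measurable_cong_sets[OF sets_sphere_measure refl])
       (auto intro!: measurable_restrict_space1)
  have G: "(\<lambda>(u, r). F (r *\<^sub>R u)) \<in> borel_measurable (?S \<Otimes>\<^sub>M ?N)"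
    using measurable_compose[OF measurable_fst id_S] by measurable
  have "(\<integral>\<^sup>+ x. F x \<partial>lborel) = (\<integral>\<^sup>+ x. F x * indicator (- {0}) x \<partial>lborel)"
    using AE_lborel_singleton[of 0] by (intro nn_integral_cong_AE) (auto elim!: eventually_mono)
  also have "\<dots> = (\<integral>\<^sup>+ x. F x \<partial>?L)"
    by (subst nn_integral_restrict_space) auto
  also have "\<dots> = (\<integral>\<^sup>+ x. (\<lambda>(u, r). F (r *\<^sub>R u)) (sgn x, norm x) \<partial>?L)"
    by (intro nn_integral_cong) (auto simp: space_restrict_space sgn_div_norm)
  also have "\<dots> = (\<integral>\<^sup>+ p. (\<lambda>(u, r). F (r *\<^sub>R u)) p \<partial>(?S \<Otimes>\<^sub>M ?N))"
    using P G by (subst eq, subst nn_integral_distr) simp_all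
  also have "\<dots> = (\<integral>\<^sup>+ u. (\<integral>\<^sup>+ r. F (r *\<^sub>R u) \<partial>?N) \<partial>?S)"
    using G by (subst N.nn_integral_fst[symmetric]) simp_all
  finally show ?thesis .
qed

section \<open>Gaussian integrals and averages over the sphere\<close>

lemma Gamma_nat_plus_half:
  "Gamma (real k + 1 / 2) = sqrt pi * fact (2 * k) / (2 ^ (2 * k) * fact k)"
proof (induction k)
  case (Suc k)
  have "Gamma (real (Suc k) + 1 / 2) = (real k + 1 / 2) * Gamma (real k + 1 / 2)"
    using Gamma_plus1[of "real k + 1 / 2"] by (simp add: add_ac nonpos_Ints_def)
  also have "\<dots> = sqrt pi * ((2 * real k + 2) * (2 * real k + 1) * fact (2 * k))
      / (4 * 2 ^ (2 * k) * ((real k + 1) * fact k))"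
    unfolding Suc by (simp add: divide_simps) (simp add: algebra_simps)
  also have "\<dots> = sqrt pi * fact (2 * Suc k) / (2 ^ (2 * Suc k) * fact (Suc k))"
    by (simp add: algebra_simps)
  finally show ?case .
qed (simp add: Gamma_one_half_real)

text \<open>
  The even and the odd moments have closed forms of different shape; at half-integers the Gamma
  function gives both by one expression.
\<close>
lemma gaussian_moment_pos:
  "has_bochner_integral lborel (\<lambda>x::real. indicator {0..} x *\<^sub>R (exp (- x\<^sup>2) * x ^ m))
     (Gamma ((real m + 1) / 2) / 2)"
proof (cases "even m")
  case True
  then obtain k where m: "m = 2 * k" by blast
  have "Gamma ((real m + 1) / 2) = sqrt pi * fact (2 * k) / (2 ^ (2 * k) * fact k)"
    unfolding Gamma_nat_plus_half[symmetric] m by (simp add: add_divide_distrib)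
  then show ?thesis using gaussian_moment_even_pos[of k] by (simp add: m mult_ac)
next
  case False
  then obtain k where m: "m = 2 * k + 1" by (elim oddE)
  have "(real m + 1) / 2 = 1 + real k"
    by (simp add: m)
  then have "Gamma ((real m + 1) / 2) = fact k"
    using Gamma_fact[of k, where 'a = real] by (simp only:)
  then show ?thesis using gaussian_moment_odd_pos[of k] by (simp add: m mult_ac)
qed

lemma nn_integral_gaussian_moment:
  "(\<integral>\<^sup>+ t. ennreal (\<bar>t\<bar> ^ k * exp (- t\<^sup>2)) \<partial>lborel) = ennreal (Gamma ((real k + 1) / 2))"
proof -
  have "has_bochner_integral lborel (\<lambda>x::real. indicator {0..} x *\<^sub>R (\<bar>x\<bar> ^ k * exp (- x\<^sup>2)))
     (Gamma ((real k + 1) / 2) / 2)"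
    using gaussian_moment_pos[of k]
    by (rule has_bochner_integral_cong[THEN iffD1, rotated -1]) (auto simp: indicator_def)
  from has_bochner_integral_even_function[OF this]
  have "has_bochner_integral lborel (\<lambda>t. \<bar>t\<bar> ^ k * exp (- t\<^sup>2)) (Gamma ((real k + 1) / 2))"
    by simp
  then show ?thesis
    by (subst nn_integral_eq_integral) (auto simp: has_bochner_integral_iff)
qed

lemma nn_integral_radial_gaussian:
  assumes "n > 0"
  shows "(\<integral>\<^sup>+ r. ennreal (r ^ k * exp (- r\<^sup>2)) \<partial>radial_measure n)
     = ennreal (Gamma ((real n + real k) / 2) / 2)"
proof -
  have "(\<integral>\<^sup>+ r. ennreal (r ^ k * exp (- r\<^sup>2)) \<partial>radial_measure n)
      = (\<integral>\<^sup>+ r. ennreal (r ^ (n - 1)) * indicator {0<..} r * ennreal (r ^ k * exp (- r\<^sup>2)) \<partial>lborel)"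
    unfolding radial_measure_def by (subst nn_integral_density) auto
  also have "\<dots> = (\<integral>\<^sup>+ r. ennreal (indicator {0..} r *\<^sub>R (exp (- r\<^sup>2) * r ^ (n - 1 + k))) \<partial>lborel)"
    by (intro nn_integral_cong_AE AE_I[of _ _ "{0}"])
       (auto simp: indicator_def power_add ennreal_mult'[symmetric] mult_ac)
  also have "\<dots> = ennreal (Gamma ((real (n - 1 + k) + 1) / 2) / 2)"
    using gaussian_moment_pos[of "n - 1 + k"]
    by (subst nn_integral_eq_integral) (auto simp: has_bochner_integral_iff indicator_def)
  finally show ?thesis using assms by (simp add: of_nat_diff)
qed

lemma AE_radial_measure_pos: "AE r in radial_measure n. r > 0"
  unfolding radial_measure_def by (subst AE_density) (auto simp: indicator_def)

text \<open>
  In polar coordinates a homogeneous function separates into its restriction to the sphere and a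
  power of the radius, so its Gaussian integral determines its integral over the sphere.
\<close>
lemma nn_integral_homogeneous_gaussian:
  fixes h :: "'a::euclidean_space \<Rightarrow> real"
  assumes [measurable]: "h \<in> borel_measurable borel"
    and nonneg: "\<And>x. h x \<ge> 0"
    and hom: "\<And>r x. r > 0 \<Longrightarrow> h (r *\<^sub>R x) = r ^ k * h x"
  shows "(\<integral>\<^sup>+ x. ennreal (h x * exp (- (norm x)\<^sup>2)) \<partial>lborel)
     = (\<integral>\<^sup>+ u. ennreal (h u) \<partial>sphere_measure) * ennreal (Gamma ((real DIM('a) + real k) / 2) / 2)"
proof -
  have "(\<integral>\<^sup>+ x. ennreal (h x * exp (- (norm x)\<^sup>2)) \<partial>lborel)
      = (\<integral>\<^sup>+ u. (\<integral>\<^sup>+ r. ennreal (h (r *\<^sub>R u) * exp (- (norm (r *\<^sub>R u))\<^sup>2)) \<partial>radial_measure DIM('a)) \<partial>sphere_measure)"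
    by (rule nn_integral_polar) measurable
  also have "\<dots> = (\<integral>\<^sup>+ u. ennreal (h u) * ennreal (Gamma ((real DIM('a) + real k) / 2) / 2) \<partial>sphere_measure)"
  proof (intro nn_integral_cong)
    fix u :: 'a assume "u \<in> space sphere_measure"
    then have u: "norm u = 1" by simp
    have "(\<integral>\<^sup>+ r. ennreal (h (r *\<^sub>R u) * exp (- (norm (r *\<^sub>R u))\<^sup>2)) \<partial>radial_measure DIM('a))
        = (\<integral>\<^sup>+ r. ennreal (h u) * ennreal (r ^ k * exp (- r\<^sup>2)) \<partial>radial_measure DIM('a))"
      using AE_radial_measure_pos[of "DIM('a)"]
      by (intro nn_integral_cong_AE)
         (auto elim!: eventually_mono simp: u hom ennreal_mult'[symmetric] nonneg mult_ac)
    also have "\<dots> = ennreal (h u) * ennreal (Gamma ((real DIM('a) + real k) / 2) / 2)"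
      by (subst nn_integral_cmult) (auto simp: nn_integral_radial_gaussian)
    finally show "(\<integral>\<^sup>+ r. ennreal (h (r *\<^sub>R u) * exp (- (norm (r *\<^sub>R u))\<^sup>2)) \<partial>radial_measure DIM('a)) = \<dots>" .
  qed
  also have "\<dots> = (\<integral>\<^sup>+ u. ennreal (h u) \<partial>sphere_measure) * ennreal (Gamma ((real DIM('a) + real k) / 2) / 2)"
    using borel_measurable_sphere_measure[OF assms(1)] by (intro nn_integral_multc) simp
  finally show ?thesis .
qed

text \<open>
  The Gaussian density is a product over the coordinates, so all but one of the factors are
  the integral of \<open>exp (- t\<^sup>2)\<close>, which is \<open>sqrt pi\<close>.
\<close>
lemma nn_integral_coordinate_gaussian:
  fixes b :: "'a::euclidean_space"
  assumes b: "b \<in> Basis"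
  shows "(\<integral>\<^sup>+ x. ennreal (\<bar>x \<bullet> b\<bar> ^ k * exp (- (norm x)\<^sup>2)) \<partial>lborel)
     = ennreal (Gamma ((real k + 1) / 2) * sqrt pi ^ (DIM('a) - 1))"
proof -
  define f where "f c t = \<bar>t\<bar> ^ (if c = b then k else 0) * exp (- t\<^sup>2)" for c :: 'a and t :: real
  have f0: "f c t \<ge> 0" for c t by (simp add: f_def)
  have "\<bar>x \<bullet> b\<bar> ^ k * exp (- (norm x)\<^sup>2) = (\<Prod>c\<in>Basis. f c (x \<bullet> c))" for x :: 'a
  proof -
    have "(norm x)\<^sup>2 = (\<Sum>c\<in>Basis. (x \<bullet> c)\<^sup>2)"
      by (subst power2_norm_eq_inner, subst euclidean_inner) (simp add: power2_eq_square)
    then have "exp (- (norm x)\<^sup>2) = (\<Prod>c\<in>Basis. exp (- (x \<bullet> c)\<^sup>2))"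
      by (simp add: exp_sum sum_negf[symmetric])
    moreover have "(\<Prod>c\<in>Basis. \<bar>x \<bullet> c\<bar> ^ (if c = b then k else 0)) = \<bar>x \<bullet> b\<bar> ^ k"
      using b by (simp add: if_distrib prod.delta cong: if_cong)
    ultimately show ?thesis by (simp add: f_def prod.distrib)
  qed
  then have "(\<integral>\<^sup>+ x. ennreal (\<bar>x \<bullet> b\<bar> ^ k * exp (- (norm x)\<^sup>2)) \<partial>lborel)
      = (\<integral>\<^sup>+ x. (\<Prod>c\<in>Basis. ennreal (f c (x \<bullet> c))) \<partial>lborel)"
    by (simp add: prod_ennreal f0)
  also have "\<dots> = (\<Prod>c\<in>(Basis :: 'a set). (\<integral>\<^sup>+ t. ennreal (f c t) \<partial>lborel))"
    by (rule nn_integral_lborel_prod) (auto simp: f_def)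
  also have "\<dots> = (\<Prod>c\<in>(Basis :: 'a set). ennreal (if c = b then Gamma ((real k + 1) / 2) else sqrt pi))"
    unfolding f_def
    using nn_integral_gaussian_moment[of k] nn_integral_gaussian_moment[of 0]
    by (intro prod.cong) (auto simp: Gamma_one_half_real)
  also have "\<dots> = ennreal (\<Prod>c\<in>(Basis :: 'a set). if c = b then Gamma ((real k + 1) / 2) else sqrt pi)"
    by (intro prod_ennreal) (auto intro!: Gamma_real_nonneg)
  also have "(\<Prod>c\<in>(Basis :: 'a set). if c = b then Gamma ((real k + 1) / 2) else sqrt pi)
      = Gamma ((real k + 1) / 2) * sqrt pi ^ (DIM('a) - 1)"
    using b by (subst prod.remove[OF _ b]) (auto simp: card_Diff_singleton)
  finally show ?thesis .
qed

lemma nn_integral_component_gaussian: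
  "(\<integral>\<^sup>+ x. ennreal (\<bar>x $ i\<bar> ^ k * exp (- (norm (x :: real ^ 'n))\<^sup>2)) \<partial>lborel)
     = ennreal (Gamma ((real k + 1) / 2) * sqrt pi ^ (CARD('n) - 1))"
  using nn_integral_coordinate_gaussian[of "axis i 1 :: real ^ 'n" k]
  by (simp add: inner_axis)

lemma nn_integral_gaussian:
  "(\<integral>\<^sup>+ x. ennreal (exp (- (norm (x::'a::euclidean_space))\<^sup>2)) \<partial>lborel) = ennreal (sqrt pi ^ DIM('a))"
proof -
  obtain b :: 'a where b: "b \<in> Basis" using nonempty_Basis by blast
  have "sqrt pi * sqrt pi ^ (DIM('a) - 1) = sqrt pi ^ DIM('a)"
    by (subst power_Suc[symmetric]) simp
  then show ?thesis
    using nn_integral_coordinate_gaussian[OF b, of 0] by (simp add: Gamma_one_half_real)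
qed

lemma nn_integral_sphere_eqI:
  fixes h :: "'a::euclidean_space \<Rightarrow> real"
  assumes "h \<in> borel_measurable borel" "\<And>x. h x \<ge> 0"
    and "\<And>r x. r > 0 \<Longrightarrow> h (r *\<^sub>R x) = r ^ k * h x"
    and G: "(\<integral>\<^sup>+ x. ennreal (h x * exp (- (norm x)\<^sup>2)) \<partial>lborel) = ennreal G" "G \<ge> 0"
  shows "(\<integral>\<^sup>+ u. ennreal (h u) \<partial>sphere_measure) = ennreal (2 * G / Gamma ((real DIM('a) + real k) / 2))"
proof -
  define c where "c = Gamma ((real DIM('a) + real k) / 2) / 2"
  have "real DIM('a) + real k > 0"
    by (intro add_pos_nonneg) auto
  then have c: "c > 0"
    unfolding c_def by (intro divide_pos_pos Gamma_real_pos) auto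
  have "(\<integral>\<^sup>+ u. ennreal (h u) \<partial>sphere_measure) = (\<integral>\<^sup>+ u. ennreal (h u) \<partial>sphere_measure) * ennreal c / ennreal c"
    using c by (simp add: ennreal_mult_divide_eq)
  also have "(\<integral>\<^sup>+ u. ennreal (h u) \<partial>sphere_measure) * ennreal c = ennreal G"
    unfolding c_def G(1)[symmetric] by (rule nn_integral_homogeneous_gaussian[symmetric]) fact+
  also have "ennreal G / ennreal c = ennreal (2 * G / Gamma ((real DIM('a) + real k) / 2))"
    using c G(2) by (subst divide_ennreal) (auto simp: c_def)
  finally show ?thesis .
qed

text \<open>
  The constant function 1 is homogeneous of degree 0.
\<close>
lemma measure_sphere_measure:
  "measure (sphere_measure :: 'a::euclidean_space measure) (sphere 0 1) = 2 * sqrt pi ^ DIM('a) / Gamma (real DIM('a) / 2)"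
proof -
  have "(\<integral>\<^sup>+ u. ennreal 1 \<partial>(sphere_measure :: 'a measure)) = ennreal (2 * sqrt pi ^ DIM('a) / Gamma ((real DIM('a) + real 0) / 2))"
    by (rule nn_integral_sphere_eqI) (auto simp: nn_integral_gaussian)
  then have "emeasure (sphere_measure :: 'a measure) (sphere 0 1) = ennreal (2 * sqrt pi ^ DIM('a) / Gamma (real DIM('a) / 2))"
    by simp
  then show ?thesis
    by (simp add: measure_def Gamma_real_nonneg)
qed

lemma sphere_average_gaussian:
  fixes h :: "'a::euclidean_space \<Rightarrow> real"
  assumes h: "h \<in> borel_measurable borel" "\<And>x. h x \<ge> 0" "\<And>r x. r > 0 \<Longrightarrow> h (r *\<^sub>R x) = r * h x"
    and G: "(\<integral>\<^sup>+ x. ennreal (h x * exp (- (norm x)\<^sup>2)) \<partial>lborel) = ennreal G" "G \<ge> 0"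
  shows "sphere_average h
     = G / sqrt pi ^ DIM('a) * (Gamma (real DIM('a) / 2) / Gamma ((real DIM('a) + 1) / 2))"
proof -
  have "(\<integral>u. h u \<partial>sphere_measure) = enn2real (\<integral>\<^sup>+ u. ennreal (h u) \<partial>sphere_measure)"
    by (rule integral_eq_nn_integral) (use h(2) borel_measurable_sphere_measure[OF h(1)] in simp_all)
  also have "(\<integral>\<^sup>+ u. ennreal (h u) \<partial>sphere_measure) = ennreal (2 * G / Gamma ((real DIM('a) + real 1) / 2))"
    by (rule nn_integral_sphere_eqI) (simp_all add: h G)
  finally have "(\<integral>u. h u \<partial>sphere_measure) = 2 * G / Gamma ((real DIM('a) + 1) / 2)"
    using G(2) by (simp add: Gamma_real_nonneg)
  then show ?thesis by (simp add: sphere_average_def measure_sphere_measure)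
qed

text \<open>
  By the inequality of the means \<open>sqrt y \<le> y / (2 * s) + s / 2\<close> for every \<open>s > 0\<close>, and the integral of the
  quadratic form \<open>y\<close> is a sum of second moments. A Gaussian coordinate has second moment \<open>1 / 2\<close>, so the
  mean of \<open>y\<close> is \<open>(norm q)\<^sup>2 / 2\<close>; choosing \<open>s\<close> as its square root is optimal.
\<close>
lemma gaussian_integral_upper:
  fixes q :: "real ^ 'n"
  assumes "q \<noteq> 0"
  shows "(\<integral>\<^sup>+ x. ennreal (sqrt (\<Sum>i\<in>UNIV. (q $ i)\<^sup>2 * (x $ i)\<^sup>2) * exp (- (norm x)\<^sup>2)) \<partial>lborel)
     \<le> ennreal (norm q / sqrt 2 * sqrt pi ^ CARD('n))"
proof -
  define s where "s = norm q / sqrt 2"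
  have s: "s > 0" using assms by (simp add: s_def)
  have nq: "(\<Sum>i\<in>UNIV. (q $ i)\<^sup>2) = (norm q)\<^sup>2"
    by (simp add: norm_vec_def L2_set_def sum_nonneg)
  have sq: "s\<^sup>2 = (norm q)\<^sup>2 / 2" by (simp add: s_def power_divide)
  have amgm: "sqrt y \<le> y / (2 * s) + s / 2" if "y \<ge> 0" for y
  proof -
    have "0 \<le> (sqrt y - s)\<^sup>2" by simp
    then have "2 * s * sqrt y \<le> y + s\<^sup>2" using that by (simp add: power2_diff mult_ac)
    then show ?thesis using s by (simp add: field_simps power2_eq_square)
  qed
  have "(\<integral>\<^sup>+ x. ennreal (sqrt (\<Sum>i\<in>UNIV. (q $ i)\<^sup>2 * (x $ i)\<^sup>2) * exp (- (norm x)\<^sup>2)) \<partial>lborel)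
     \<le> (\<integral>\<^sup>+ x. (\<Sum>i\<in>UNIV. ennreal ((q $ i)\<^sup>2 / (2 * s)) * ennreal (\<bar>x $ i\<bar> ^ 2 * exp (- (norm x)\<^sup>2)))
            + ennreal (s / 2) * ennreal (exp (- (norm x)\<^sup>2)) \<partial>lborel)"
  proof (intro nn_integral_mono)
    fix x :: "real ^ 'n"
    have "sqrt (\<Sum>i\<in>UNIV. (q $ i)\<^sup>2 * (x $ i)\<^sup>2) * exp (- (norm x)\<^sup>2)
        \<le> ((\<Sum>i\<in>UNIV. (q $ i)\<^sup>2 * (x $ i)\<^sup>2) / (2 * s) + s / 2) * exp (- (norm x)\<^sup>2)"
      by (intro mult_right_mono amgm sum_nonneg) auto
    also have "\<dots> = (\<Sum>i\<in>UNIV. (q $ i)\<^sup>2 / (2 * s) * (\<bar>x $ i\<bar> ^ 2 * exp (- (norm x)\<^sup>2)))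
        + s / 2 * exp (- (norm x)\<^sup>2)"
      unfolding sum_divide_distrib distrib_right sum_distrib_right by (simp add: mult_ac)
    finally show "ennreal (sqrt (\<Sum>i\<in>UNIV. (q $ i)\<^sup>2 * (x $ i)\<^sup>2) * exp (- (norm x)\<^sup>2))
      \<le> (\<Sum>i\<in>UNIV. ennreal ((q $ i)\<^sup>2 / (2 * s)) * ennreal (\<bar>x $ i\<bar> ^ 2 * exp (- (norm x)\<^sup>2)))
            + ennreal (s / 2) * ennreal (exp (- (norm x)\<^sup>2))"
      using s by (simp add: ennreal_mult[symmetric] sum_ennreal ennreal_plus[symmetric] sum_nonneg
          ennreal_leI del: ennreal_plus)
  qed
  also have "\<dots> = (\<Sum>i\<in>UNIV. ennreal ((q $ i)\<^sup>2 / (2 * s)) * ennreal (Gamma ((real 2 + 1) / 2) * sqrt pi ^ (CARD('n) - 1)))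
      + ennreal (s / 2) * ennreal (sqrt pi ^ CARD('n))"
    using nn_integral_component_gaussian[where 'n = 'n and k = 2] nn_integral_gaussian[where 'a = "real^'n"]
    by (subst nn_integral_add, simp, simp, subst nn_integral_sum, simp)
       (simp add: nn_integral_cmult)
  also have "\<dots> = ennreal ((\<Sum>i\<in>UNIV. (q $ i)\<^sup>2 / (2 * s) * (Gamma ((real 2 + 1) / 2) * sqrt pi ^ (CARD('n) - 1)))
      + s / 2 * sqrt pi ^ CARD('n))"
    using s by (simp add: ennreal_mult[symmetric] sum_ennreal ennreal_plus[symmetric] sum_nonneg Gamma_real_nonneg
         del: ennreal_plus)
  also have "Gamma ((real 2 + 1) / 2) = sqrt pi / 2"
    using Gamma_nat_plus_half[of 1] by (simp add: fact_numeral)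
  also have "sqrt pi / 2 * sqrt pi ^ (CARD('n) - 1) = sqrt pi ^ CARD('n) / 2"
    by (cases "CARD('n)") auto
  also have "(\<Sum>i\<in>UNIV. (q $ i)\<^sup>2 / (2 * s) * (sqrt pi ^ CARD('n) / 2)) = s / 2 * sqrt pi ^ CARD('n)"
    using sq s nq unfolding sum_distrib_right[symmetric] sum_divide_distrib[symmetric]
    by (simp add: field_simps power2_eq_square)
  finally show ?thesis by (simp add: s_def)
qed

text \<open>
  The Cauchy-Schwarz inequality for the vectors with entries \<open>q $ i\<close> and \<open>q $ i * x $ i\<close> (in absolute
  value) bounds the integrand from below by a combination of the \<open>\<bar>x $ i\<bar>\<close> whose coefficients
  \<open>(q $ i)\<^sup>2 / norm q\<close> add up to \<open>norm q\<close>.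
\<close>
lemma gaussian_integral_lower:
  fixes q :: "real ^ 'n"
  assumes "q \<noteq> 0"
  shows "ennreal (norm q * sqrt pi ^ (CARD('n) - 1))
    \<le> (\<integral>\<^sup>+ x. ennreal (sqrt (\<Sum>i\<in>UNIV. (q $ i)\<^sup>2 * (x $ i)\<^sup>2) * exp (- (norm x)\<^sup>2)) \<partial>lborel)"
proof -
  have q: "norm q > 0" using assms by simp
  have nq: "(\<Sum>i\<in>UNIV. (q $ i)\<^sup>2) = (norm q)\<^sup>2"
    by (simp add: norm_vec_def L2_set_def sum_nonneg)
  have "norm q * sqrt pi ^ (CARD('n) - 1) = (\<Sum>i\<in>UNIV. (q $ i)\<^sup>2 / norm q * (Gamma ((real 1 + 1) / 2) * sqrt pi ^ (CARD('n) - 1)))"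
    using q nq unfolding sum_distrib_right[symmetric] sum_divide_distrib[symmetric]
    by (simp add: power2_eq_square)
  then have "ennreal (norm q * sqrt pi ^ (CARD('n) - 1))
      = (\<Sum>i\<in>UNIV. ennreal ((q $ i)\<^sup>2 / norm q) * ennreal (Gamma ((real 1 + 1) / 2) * sqrt pi ^ (CARD('n) - 1)))"
    by (simp add: ennreal_mult[symmetric] sum_ennreal Gamma_real_nonneg)
  also have "\<dots> = (\<integral>\<^sup>+ x. (\<Sum>i\<in>UNIV. ennreal ((q $ i)\<^sup>2 / norm q) * ennreal (\<bar>x $ i\<bar> ^ 1 * exp (- (norm (x::real^'n))\<^sup>2))) \<partial>lborel)"
    using nn_integral_component_gaussian[where 'n = 'n and k = 1]
    by (subst nn_integral_sum, simp) (simp add: nn_integral_cmult)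
  also have "\<dots> \<le> (\<integral>\<^sup>+ x. ennreal (sqrt (\<Sum>i\<in>UNIV. (q $ i)\<^sup>2 * (x $ i)\<^sup>2) * exp (- (norm x)\<^sup>2)) \<partial>lborel)"
  proof (intro nn_integral_mono)
    fix x :: "real ^ 'n"
    have "(\<Sum>i\<in>UNIV. \<bar>q $ i\<bar> * \<bar>q $ i * x $ i\<bar>) \<le> L2_set (($) q) UNIV * L2_set (\<lambda>i. q $ i * x $ i) UNIV"
      by (rule L2_set_mult_ineq)
    also have "\<dots> = norm q * sqrt (\<Sum>i\<in>UNIV. (q $ i)\<^sup>2 * (x $ i)\<^sup>2)"
      by (simp add: norm_vec_def L2_set_def power_mult_distrib)
    finally have "(\<Sum>i\<in>UNIV. (q $ i)\<^sup>2 * \<bar>x $ i\<bar>) \<le> norm q * sqrt (\<Sum>i\<in>UNIV. (q $ i)\<^sup>2 * (x $ i)\<^sup>2)"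
      by (simp add: abs_mult power2_eq_square mult.assoc[symmetric])
    then have "(\<Sum>i\<in>UNIV. (q $ i)\<^sup>2 * \<bar>x $ i\<bar>) / norm q \<le> sqrt (\<Sum>i\<in>UNIV. (q $ i)\<^sup>2 * (x $ i)\<^sup>2)"
      using q by (simp add: field_simps)
    then have "(\<Sum>i\<in>UNIV. (q $ i)\<^sup>2 * \<bar>x $ i\<bar>) / norm q * exp (- (norm x)\<^sup>2)
        \<le> sqrt (\<Sum>i\<in>UNIV. (q $ i)\<^sup>2 * (x $ i)\<^sup>2) * exp (- (norm x)\<^sup>2)"
      by (rule mult_right_mono) simp
    also have "(\<Sum>i\<in>UNIV. (q $ i)\<^sup>2 * \<bar>x $ i\<bar>) / norm q * exp (- (norm x)\<^sup>2)
        = (\<Sum>i\<in>UNIV. (q $ i)\<^sup>2 / norm q * (\<bar>x $ i\<bar> ^ 1 * exp (- (norm x)\<^sup>2)))"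
      unfolding sum_divide_distrib distrib_right sum_distrib_right by (simp add: mult_ac)
    finally show "(\<Sum>i\<in>UNIV. ennreal ((q $ i)\<^sup>2 / norm q) * ennreal (\<bar>x $ i\<bar> ^ 1 * exp (- (norm x)\<^sup>2)))
      \<le> ennreal (sqrt (\<Sum>i\<in>UNIV. (q $ i)\<^sup>2 * (x $ i)\<^sup>2) * exp (- (norm x)\<^sup>2))"
      by (simp add: ennreal_mult[symmetric] sum_ennreal ennreal_leI)
  qed
  finally show ?thesis .
qed

lemma ellipsoid_sphere_average_bounds:
  fixes q :: "real ^ 'n"
  assumes "q \<noteq> 0"
  defines "G \<equiv> Gamma (real CARD('n) / 2) / Gamma ((real CARD('n) + 1) / 2)"
  defines "a \<equiv> sphere_average (\<lambda>x :: real ^ 'n. sqrt (\<Sum>i\<in>UNIV. (q $ i)\<^sup>2 * (x $ i)\<^sup>2))"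
  shows "a \<le> norm q / sqrt 2 * G" "norm q / sqrt pi * G \<le> a"
proof -
  define h where "h x = sqrt (\<Sum>i\<in>UNIV. (q $ i)\<^sup>2 * (x $ i)\<^sup>2)" for x :: "real ^ 'n"
  have G0: "G \<ge> 0" by (simp add: G_def Gamma_real_nonneg)
  define I where "I = (\<integral>\<^sup>+ x. ennreal (h x * exp (- (norm x)\<^sup>2)) \<partial>lborel)"
  have up: "I \<le> ennreal (norm q / sqrt 2 * sqrt pi ^ CARD('n))"
    unfolding I_def h_def by (rule gaussian_integral_upper[OF assms(1)])
  have lo: "ennreal (norm q * sqrt pi ^ (CARD('n) - 1)) \<le> I"
    unfolding I_def h_def by (rule gaussian_integral_lower[OF assms(1)])
  have "I < \<infinity>" using up by (simp add: le_less_trans)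
  then obtain m where m: "I = ennreal m" "m \<ge> 0" by (cases I) auto
  have "a = m / sqrt pi ^ DIM(real^'n) * (Gamma (real DIM(real^'n) / 2) / Gamma ((real DIM(real^'n) + 1) / 2))"
    unfolding a_def h_def[symmetric]
  proof (rule sphere_average_gaussian)
    show "h \<in> borel_measurable borel"
      unfolding h_def by (intro borel_measurable_continuous_onI continuous_intros)
    show "h x \<ge> 0" for x by (simp add: h_def sum_nonneg)
    show "h (r *\<^sub>R x) = r * h x" if "r > 0" for r x
      using that by (simp add: h_def power_mult_distrib mult.left_commute sum_distrib_left[symmetric] real_sqrt_mult)
  qed (use m in \<open>auto simp: I_def\<close>)
  then have a: "a = m / sqrt pi ^ CARD('n) * G" by (simp add: G_def)
  have "m \<le> norm q / sqrt 2 * sqrt pi ^ CARD('n)"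
    using up unfolding m by (subst (asm) ennreal_le_iff) auto
  then have "m / sqrt pi ^ CARD('n) \<le> norm q / sqrt 2" by (simp add: field_simps)
  then show "a \<le> norm q / sqrt 2 * G" unfolding a by (rule mult_right_mono) (rule G0)
  have "norm q * sqrt pi ^ (CARD('n) - 1) \<le> m"
    using lo m by simp
  then have "norm q / sqrt pi \<le> m / sqrt pi ^ CARD('n)"
    by (cases "CARD('n)") (auto simp add: field_simps)
  then show "norm q / sqrt pi * G \<le> a" unfolding a by (rule mult_right_mono) (rule G0)
qed

section \<open>Anisotropic neighbourhoods of the unit sphere\<close>

text \<open>
  The linear map \<open>T\<close> takes the unit ball to an ellipsoid, and \<open>D\<close> is its inverse. In the coordinates
  in which the ellipsoid is the unit ball, a ball of radius \<open>\<epsilon>\<close> is \<open>\<epsilon>\<close> times the image \<open>K\<close> of the unit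
  ball under \<open>D\<close>. As \<open>D\<close> is self-adjoint, the support function of \<open>K\<close> is \<open>\<lambda>u. norm (D u)\<close>.
\<close>
locale selfadjoint_iso =
  fixes D T :: "'a::euclidean_space \<Rightarrow> 'a" and M :: real
  assumes linear_D: "linear D" and linear_T: "linear T"
    and selfadjoint: "\<And>x y. D x \<bullet> y = x \<bullet> D y"
    and TD [simp]: "\<And>x. T (D x) = x" and DT [simp]: "\<And>x. D (T x) = x"
    and norm_D_le: "\<And>x. norm (D x) \<le> M * norm x"
    and M_pos: "M > 0"
begin

text \<open>
  The Minkowski sum of the unit sphere and \<open>\<epsilon>\<close> times \<open>K\<close>.
\<close>
definition nbhd :: "real \<Rightarrow> 'a set" where
  "nbhd \<epsilon> = {y. \<exists>z\<in>sphere 0 1. norm (T (y - z)) \<le> \<epsilon>}"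

lemma compact_nbhd: "compact (nbhd \<epsilon>)"
proof -
  have "nbhd \<epsilon> = {z + w |z w. z \<in> sphere 0 1 \<and> w \<in> D ` cball 0 \<epsilon>}"
  proof (intro set_eqI iffI)
    fix y assume "y \<in> nbhd \<epsilon>"
    then obtain z where z: "z \<in> sphere 0 1" "norm (T (y - z)) \<le> \<epsilon>" by (auto simp: nbhd_def)
    have "y = z + D (T (y - z))" by simp
    moreover have "D (T (y - z)) \<in> D ` cball 0 \<epsilon>" using z(2) by (intro imageI) simp
    ultimately show "y \<in> {z + w |z w. z \<in> sphere 0 1 \<and> w \<in> D ` cball 0 \<epsilon>}"
      using z(1) by blast
  qed (force simp: nbhd_def)
  moreover have "compact (D ` cball 0 \<epsilon>)"
    by (intro compact_continuous_image linear_continuous_on linear_D[THEN linear_conv_bounded_linear[THEN iffD1]]) auto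
  ultimately show ?thesis by (simp only: compact_sums compact_sphere)
qed

text \<open>
  If \<open>y = z + w\<close> with \<open>z\<close> on the sphere and \<open>w\<close> in \<open>\<epsilon>\<close> times \<open>K\<close>, then the component of \<open>w\<close> along \<open>y\<close>
  is at most \<open>\<epsilon>\<close> times the support function in the direction of \<open>y\<close>; the component across \<open>y\<close>
  changes the distance from the sphere only to second order.
\<close>
lemma nbhd_outer:
  assumes y: "y \<in> nbhd \<epsilon>" "y \<noteq> 0"
  shows "\<bar>norm y - 1\<bar> \<le> \<epsilon> * norm (D (sgn y)) + 2 * M\<^sup>2 * \<epsilon>\<^sup>2"
proof -
  obtain z where z: "norm z = 1" "norm (T (y - z)) \<le> \<epsilon>" using y by (auto simp: nbhd_def)
  define w where "w = y - z"
  define r where "r = norm y"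
  define u where "u = sgn y"
  define h where "h = norm (D u)"
  have e0: "\<epsilon> \<ge> 0" using z(2) norm_ge_zero order_trans by blast
  have u: "norm u = 1" "y = r *\<^sub>R u" using y by (auto simp: u_def norm_sgn r_def sgn_div_norm)
  have h: "0 \<le> h" "h \<le> M" using norm_D_le[of u] u by (auto simp: h_def)
  have w: "norm w \<le> M * \<epsilon>"
    using norm_D_le[of "T w"] mult_left_mono[OF z(2), of M] M_pos
    unfolding w_def DT by linarith
  have w2: "(norm w)\<^sup>2 \<le> M\<^sup>2 * \<epsilon>\<^sup>2"
    using power_mono[OF w, of 2] by (simp add: power_mult_distrib)
  have uw: "\<bar>u \<bullet> w\<bar> \<le> h * \<epsilon>"
  proof -
    have "u \<bullet> w = D u \<bullet> T w" using selfadjoint[of u "T w"] by simp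
    also have "\<bar>\<dots>\<bar> \<le> norm (D u) * norm (T w)" by (rule Cauchy_Schwarz_ineq2)
    also have "\<dots> \<le> h * \<epsilon>" using z(2) by (auto simp: h_def w_def intro: mult_left_mono)
    finally show ?thesis .
  qed
  have r0: "r \<ge> 0" by (simp add: r_def)
  have rw: "\<bar>r - 1\<bar> \<le> M * \<epsilon>"
    using norm_triangle_ineq3[of y z] w z by (simp add: r_def w_def)
  have "r\<^sup>2 - 1 = (r - 1) * (r + 1)"
    by (simp add: power2_eq_square algebra_simps)
  then have sq: "\<bar>r\<^sup>2 - 1\<bar> = \<bar>r - 1\<bar> * (r + 1)"
    using r0 by (simp add: abs_mult)
  have "1 = (norm (y - w))\<^sup>2" using z by (simp add: w_def)
  also have "\<dots> = r\<^sup>2 - 2 * r * (u \<bullet> w) + (norm w)\<^sup>2"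
    unfolding power2_norm_eq_inner u(2)
    using u(1) by (simp add: inner_diff inner_commute power2_eq_square norm_eq_1)
  finally have "\<bar>r\<^sup>2 - 1\<bar> = \<bar>2 * r * (u \<bullet> w) - (norm w)\<^sup>2\<bar>" by simp
  also have "\<dots> \<le> 2 * r * \<bar>u \<bullet> w\<bar> + (norm w)\<^sup>2"
    using r0 abs_triangle_ineq4[of "2 * r * (u \<bullet> w)" "(norm w)\<^sup>2"] by (simp add: abs_mult)
  also have "\<dots> \<le> 2 * r * (h * \<epsilon>) + M\<^sup>2 * \<epsilon>\<^sup>2"
    using w2 r0 uw by (intro add_mono mult_left_mono) auto
  \<comment> \<open>Compared with \<open>2 * r\<close>, the factor \<open>r + 1\<close> loses at most \<open>M * \<epsilon>\<close>; the second copy of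
    \<open>M\<^sup>2 * \<epsilon>\<^sup>2\<close> pays for this.\<close>
  also have "\<dots> \<le> (r + 1) * (\<epsilon> * h + 2 * M\<^sup>2 * \<epsilon>\<^sup>2)"
  proof -
    have "(r - 1) * (\<epsilon> * h) \<le> (M * \<epsilon>) * (\<epsilon> * M)"
      using rw h e0 M_pos by (intro mult_mono mult_left_mono) auto
    moreover have "0 \<le> r * (M\<^sup>2 * \<epsilon>\<^sup>2)" using r0 by simp
    moreover have "0 \<le> M\<^sup>2 * \<epsilon>\<^sup>2" by simp
    ultimately show ?thesis by (simp add: algebra_simps power2_eq_square)
  qed
  finally have "\<bar>r - 1\<bar> * (r + 1) \<le> (\<epsilon> * h + 2 * M\<^sup>2 * \<epsilon>\<^sup>2) * (r + 1)"
    unfolding sq by (simp only: mult.commute)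
  then have "\<bar>r - 1\<bar> \<le> \<epsilon> * h + 2 * M\<^sup>2 * \<epsilon>\<^sup>2"
    by (rule mult_right_le_imp_le) (use r0 in simp)
  then show ?thesis by (simp add: r_def h_def u_def)
qed

text \<open>
  Let \<open>k\<close> be the point of \<open>K\<close> that is extremal in the direction \<open>u\<close>. On the segment of the points
  \<open>r *\<^sub>R u - s *\<^sub>R k\<close> with \<open>\<bar>s\<bar> \<le> \<epsilon>\<close>, one end is outside the open unit ball and the other one is inside
  the closed ball, so the segment meets the sphere.
\<close>
lemma nbhd_inner:
  assumes u: "norm u = 1" and e: "\<epsilon> > 0" "2 * M * \<epsilon> \<le> 1"
    and r: "\<bar>r - 1\<bar> \<le> \<epsilon> * norm (D u) - 2 * M\<^sup>2 * \<epsilon>\<^sup>2"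
  shows "r *\<^sub>R u \<in> nbhd \<epsilon>"
proof -
  define h where "h = norm (D u)"
  have "D u \<noteq> 0" using u TD[of u] linear_0[OF linear_T] by force
  then have h: "0 < h" "h \<le> M" using norm_D_le[of u] u by (auto simp: h_def)
  define k where "k = D (D u) /\<^sub>R h"
  have Tk: "T k = D u /\<^sub>R h" by (simp add: k_def linear_scale[OF linear_T])
  have nTk: "norm (T k) = 1" using h by (simp add: Tk h_def)
  have k: "norm k \<le> M" using norm_D_le[of "T k"] nTk by simp
  have uk: "u \<bullet> k = h"
  proof -
    have "u \<bullet> k = (D u \<bullet> D u) / h" using selfadjoint[of u "D u"] by (simp add: k_def divide_inverse mult.commute)
    then show ?thesis using h by (simp add: h_def power2_norm_eq_inner[symmetric] power2_eq_square)
  qed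
  have hk: "h \<le> norm k" using norm_cauchy_schwarz[of u k] u uk by simp
  have hk2: "h\<^sup>2 \<le> (norm k)\<^sup>2" using hk h by (intro power_mono) auto
  define f where "f s = (norm (r *\<^sub>R u - s *\<^sub>R k))\<^sup>2" for s
  \<comment> \<open>Split into the components along \<open>u\<close> and across it.\<close>
  have f: "f s = (r - s * h)\<^sup>2 + s\<^sup>2 * ((norm k)\<^sup>2 - h\<^sup>2)" for s
  proof -
    have "f s = r\<^sup>2 * (u \<bullet> u) - 2 * r * s * (u \<bullet> k) + s\<^sup>2 * (k \<bullet> k)"
      unfolding f_def power2_norm_eq_inner
      by (simp add: inner_diff inner_commute power2_eq_square algebra_simps)
    then show ?thesis using u uk
      by (simp add: power2_norm_eq_inner[symmetric]) (simp add: power2_eq_square algebra_simps)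
  qed
  define a where "a = 2 * M\<^sup>2 * \<epsilon>\<^sup>2"
  have a: "0 \<le> a" "a \<le> 1"
  proof -
    have "(2 * M * \<epsilon>)\<^sup>2 \<le> 1" using e M_pos by (intro power_le_one) auto
    then show "0 \<le> a" "a \<le> 1" by (auto simp: a_def power_mult_distrib)
  qed
  have eh: "\<epsilon> * h \<le> \<epsilon> * M" using h e by (intro mult_left_mono) auto
  have r': "r - \<epsilon> * h \<le> 1 - a" "1 \<le> r + \<epsilon> * h" "r - \<epsilon> * h \<ge> 0"
  proof -
    have "r - 1 \<le> \<epsilon> * h - a" "1 - r \<le> \<epsilon> * h - a"
      using r unfolding h_def a_def by linarith+
    moreover have "2 * (\<epsilon> * M) \<le> 1" using e(2) by (simp add: mult_ac)
    ultimately show "r - \<epsilon> * h \<le> 1 - a" "1 \<le> r + \<epsilon> * h" "r - \<epsilon> * h \<ge> 0"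
      using a eh by linarith+
  qed
  have "1 \<le> (r + \<epsilon> * h)\<^sup>2" using r' by (simp add: one_le_power)
  then have lo: "1 \<le> f (- \<epsilon>)" using hk2 by (simp add: f add_increasing2)
  have hi: "f \<epsilon> \<le> 1"
  proof -
    \<comment> \<open>The margin \<open>a\<close> is twice an upper bound for the contribution of the component across \<open>u\<close>.\<close>
    have "(r - \<epsilon> * h)\<^sup>2 \<le> (1 - a)\<^sup>2" using r' by (intro power_mono) auto
    also have "\<dots> \<le> (1 - a) * 1" unfolding power2_eq_square using a by (intro mult_left_mono) auto
    finally have "(r - \<epsilon> * h)\<^sup>2 \<le> 1 - a" by simp
    moreover have "\<epsilon>\<^sup>2 * ((norm k)\<^sup>2 - h\<^sup>2) \<le> \<epsilon>\<^sup>2 * M\<^sup>2"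
    proof (rule mult_left_mono)
      show "(norm k)\<^sup>2 - h\<^sup>2 \<le> M\<^sup>2"
        using power_mono[OF k norm_ge_zero, of 2] zero_le_power2[of h] by linarith
    qed simp
    moreover have "\<epsilon>\<^sup>2 * M\<^sup>2 \<ge> 0" by simp
    moreover have "a = 2 * (\<epsilon>\<^sup>2 * M\<^sup>2)" by (simp add: a_def)
    ultimately show ?thesis unfolding f by linarith
  qed
  have "\<exists>s. - \<epsilon> \<le> s \<and> s \<le> \<epsilon> \<and> f s = 1"
    using lo hi e unfolding f_def
    by (intro IVT2') (auto intro!: continuous_intros)
  then obtain s where s: "- \<epsilon> \<le> s" "s \<le> \<epsilon>" "f s = 1" by blast
  have "norm (T (r *\<^sub>R u - (r *\<^sub>R u - s *\<^sub>R k))) \<le> \<epsilon>"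
    using s nTk by (simp add: linear_scale[OF linear_T])
  moreover have "r *\<^sub>R u - s *\<^sub>R k \<in> sphere 0 1"
    using s(3) by (simp add: f_def power2_eq_1_iff) (metis norm_ge_zero not_one_le_zero neg_0_le_iff_le)
  ultimately show ?thesis unfolding nbhd_def by blast
qed

lemma measurable_D [measurable]: "D \<in> borel_measurable borel"
  by (intro borel_measurable_continuous_onI linear_continuous_on linear_D[THEN linear_conv_bounded_linear[THEN iffD1]])

lemma norm_D_sphere: "u \<in> sphere 0 1 \<Longrightarrow> norm (D u) \<le> M"
  using norm_D_le[of u] by simp

lemma integrable_norm_D: "integrable sphere_measure (\<lambda>u. norm (D u))"
proof -
  interpret finite_measure "sphere_measure :: 'a measure" by (rule finite_sphere_measure)
  have [measurable]: "(\<lambda>u::'a. norm (D u)) \<in> borel_measurable sphere_measure"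
    by (rule borel_measurable_sphere_measure) measurable
  show ?thesis by (rule integrable_const_bound[of _ M]) (auto intro!: AE_I2 norm_D_sphere)
qed

abbreviation "L \<equiv> \<integral>u. norm (D u) \<partial>sphere_measure"

text \<open>
  The two inclusions of the neighbourhood between radial shells turn, in polar coordinates, into
  bounds for the inner integral over the radius.
\<close>
lemma emeasure_nbhd:
  "emeasure lborel (nbhd \<epsilon>)
    = (\<integral>\<^sup>+ u. (\<integral>\<^sup>+ r. ennreal (r ^ (DIM('a) - 1)) * indicator {0<..} r * indicator (nbhd \<epsilon>) (r *\<^sub>R u) \<partial>lborel) \<partial>sphere_measure)"
proof -
  have [measurable]: "nbhd \<epsilon> \<in> sets borel" by (simp add: compact_nbhd compact_imp_closed)
  have "emeasure lborel (nbhd \<epsilon>) = (\<integral>\<^sup>+ x. indicator (nbhd \<epsilon>) x \<partial>lborel)" by simp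
  also have "\<dots> = (\<integral>\<^sup>+ u. (\<integral>\<^sup>+ r. indicator (nbhd \<epsilon>) (r *\<^sub>R u) \<partial>radial_measure DIM('a)) \<partial>sphere_measure)"
    by (rule nn_integral_polar) measurable
  finally show ?thesis by (subst (asm) nn_integral_radial_measure) measurable
qed

lemma integral_norm_D_affine:
  "integrable sphere_measure (\<lambda>u. c * (\<epsilon> * norm (D u) + d))"
  "(\<integral>u. c * (\<epsilon> * norm (D u) + d) \<partial>sphere_measure) = c * (\<epsilon> * L + d * measure sphere_measure (sphere (0::'a) 1))"
proof -
  interpret finite_measure "sphere_measure :: 'a measure" by (rule finite_sphere_measure)
  show "integrable sphere_measure (\<lambda>u. c * (\<epsilon> * norm (D u) + d))"
    using integrable_norm_D by simp
  show "(\<integral>u. c * (\<epsilon> * norm (D u) + d) \<partial>sphere_measure) = c * (\<epsilon> * L + d * measure sphere_measure (sphere (0::'a) 1))"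
    using integrable_norm_D by (simp add: mult.commute)
qed

lemma measure_nbhd_upper:
  assumes e: "\<epsilon> > 0" "2 * M * \<epsilon> \<le> 1"
  shows "measure lborel (nbhd \<epsilon>) \<le> 2 * (1 + 2 * M * \<epsilon>) ^ (DIM('a) - 1) * (\<epsilon> * L + 2 * M\<^sup>2 * \<epsilon>\<^sup>2 * measure sphere_measure (sphere (0::'a) 1))"
proof -
  let ?c = "(1 + 2 * M * \<epsilon>) ^ (DIM('a) - 1)"
  let ?g = "\<lambda>u. \<epsilon> * norm (D u) + 2 * M\<^sup>2 * \<epsilon>\<^sup>2"
  have g: "0 \<le> ?g u" "?g u \<le> 2 * M * \<epsilon>" if "u \<in> sphere 0 1" for u
  proof -
    show "0 \<le> ?g u" using e by simp
    have "\<epsilon> * norm (D u) \<le> \<epsilon> * M" using norm_D_sphere[OF that] e by simp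
    moreover have "2 * M * \<epsilon> * (M * \<epsilon>) \<le> 1 * (M * \<epsilon>)" using e M_pos by (intro mult_right_mono) auto
    ultimately show "?g u \<le> 2 * M * \<epsilon>" by (simp add: power2_eq_square mult_ac)
  qed
  have "emeasure lborel (nbhd \<epsilon>) \<le> (\<integral>\<^sup>+ u. ennreal (2 * ?c * ?g u) \<partial>sphere_measure)"
    unfolding emeasure_nbhd
  proof (intro nn_integral_mono)
    fix u :: 'a assume "u \<in> space sphere_measure"
    then have u: "u \<in> sphere 0 1" by simp
    have "(\<integral>\<^sup>+ r. ennreal (r ^ (DIM('a) - 1)) * indicator {0<..} r * indicator (nbhd \<epsilon>) (r *\<^sub>R u) \<partial>lborel)
       \<le> (\<integral>\<^sup>+ r. ennreal ?c * indicator {1 - ?g u..1 + ?g u} r \<partial>lborel)"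
    proof (intro nn_integral_mono)
      fix r :: real
      show "ennreal (r ^ (DIM('a) - 1)) * indicator {0<..} r * indicator (nbhd \<epsilon>) (r *\<^sub>R u)
        \<le> ennreal ?c * indicator {1 - ?g u..1 + ?g u} r"
      proof (cases "r > 0 \<and> r *\<^sub>R u \<in> nbhd \<epsilon>")
        case True
        have "norm (r *\<^sub>R u) = r" "sgn (r *\<^sub>R u) = u" "r *\<^sub>R u \<noteq> 0"
          using True u by (auto simp: sgn_div_norm)
        then have "\<bar>r - 1\<bar> \<le> ?g u"
          using nbhd_outer[of "r *\<^sub>R u" \<epsilon>] True by metis
        moreover from this have "r \<le> 1 + 2 * M * \<epsilon>" using g[OF u] by linarith
        then have "r ^ (DIM('a) - 1) \<le> ?c" using True by (intro power_mono) auto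
        ultimately show ?thesis using True by (auto simp: indicator_def intro!: ennreal_leI)
      qed (auto simp: indicator_def)
    qed
    also have "\<dots> = ennreal ?c * ennreal (2 * ?g u)"
      using g[OF u] by (simp add: nn_integral_cmult_indicator emeasure_lborel_Icc_eq)
    also have "\<dots> = ennreal (2 * ?c * ?g u)"
      using e M_pos by (subst ennreal_mult'[symmetric]) (auto simp: mult_ac)
    finally show "(\<integral>\<^sup>+ r. ennreal (r ^ (DIM('a) - 1)) * indicator {0<..} r * indicator (nbhd \<epsilon>) (r *\<^sub>R u) \<partial>lborel)
       \<le> ennreal (2 * ?c * ?g u)" .
  qed
  also have "\<dots> = ennreal (\<integral>u. 2 * ?c * ?g u \<partial>sphere_measure)"
    using e M_pos by (intro nn_integral_eq_integral integral_norm_D_affine(1)) auto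
  also have "(\<integral>u. 2 * ?c * ?g u \<partial>sphere_measure) = 2 * ?c * (\<epsilon> * L + 2 * M\<^sup>2 * \<epsilon>\<^sup>2 * measure sphere_measure (sphere (0::'a) 1))"
    by (rule integral_norm_D_affine(2))
  finally have "emeasure lborel (nbhd \<epsilon>)
      \<le> ennreal (2 * ?c * (\<epsilon> * L + 2 * M\<^sup>2 * \<epsilon>\<^sup>2 * measure sphere_measure (sphere (0::'a) 1)))" .
  moreover have "L \<ge> 0" by simp
  ultimately show ?thesis
    using e M_pos unfolding measure_def[of lborel] by (intro enn2real_leI) simp_all
qed

lemma measure_nbhd_lower:
  assumes e: "\<epsilon> > 0" "2 * M * \<epsilon> \<le> 1"
  shows "2 * (1 - 2 * M * \<epsilon>) ^ (DIM('a) - 1) * (\<epsilon> * L - 2 * M\<^sup>2 * \<epsilon>\<^sup>2 * measure sphere_measure (sphere (0::'a) 1)) \<le> measure lborel (nbhd \<epsilon>)"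
proof -
  let ?c = "(1 - 2 * M * \<epsilon>) ^ (DIM('a) - 1)"
  let ?g = "\<lambda>u. \<epsilon> * norm (D u) + - (2 * M\<^sup>2 * \<epsilon>\<^sup>2)"
  have Me: "M * \<epsilon> > 0" using e M_pos by simp
  have fin: "emeasure lborel (nbhd \<epsilon>) < \<infinity>"
    using compact_nbhd emeasure_compact_finite by blast
  have int: "integrable sphere_measure (\<lambda>u. 2 * ?c * ?g u)"
    by (rule integral_norm_D_affine(1))
  have "2 * ?c * (\<epsilon> * L + - (2 * M\<^sup>2 * \<epsilon>\<^sup>2) * measure sphere_measure (sphere (0::'a) 1)) = (\<integral>u. 2 * ?c * ?g u \<partial>sphere_measure)"
    by (rule integral_norm_D_affine(2)[symmetric])
  \<comment> \<open>Where \<open>norm (D u)\<close> is smaller than the error term, \<open>?g u\<close> is negative and the shell is empty.\<close>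
  also have "\<dots> \<le> (\<integral>u. max 0 (2 * ?c * ?g u) \<partial>sphere_measure)"
    using int by (intro integral_mono integrable_max) auto
  finally have "ennreal (2 * ?c * (\<epsilon> * L + - (2 * M\<^sup>2 * \<epsilon>\<^sup>2) * measure sphere_measure (sphere (0::'a) 1)))
     \<le> ennreal (\<integral>u. max 0 (2 * ?c * ?g u) \<partial>sphere_measure)" by (rule ennreal_leI)
  also have "\<dots> = (\<integral>\<^sup>+ u. ennreal (max 0 (2 * ?c * ?g u)) \<partial>sphere_measure)"
    using int by (intro nn_integral_eq_integral[symmetric] integrable_max) auto
  also have "\<dots> \<le> emeasure lborel (nbhd \<epsilon>)"
    unfolding emeasure_nbhd
  proof (intro nn_integral_mono)
    fix u :: 'a assume "u \<in> space sphere_measure"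
    then have u: "u \<in> sphere 0 1" by simp
    have g: "?g u \<le> M * \<epsilon>"
    proof -
      have "\<epsilon> * norm (D u) \<le> \<epsilon> * M" using norm_D_sphere[OF u] e by simp
      moreover have "0 \<le> 2 * M\<^sup>2 * \<epsilon>\<^sup>2" by simp
      ultimately show ?thesis by (simp only: mult.commute[of M])
    qed
    have "ennreal (max 0 (2 * ?c * ?g u)) = ennreal (2 * ?c * ?g u)"
    proof (cases "0 \<le> 2 * ?c * ?g u")
      case False
      then have "max 0 (2 * ?c * ?g u) = 0" "2 * ?c * ?g u \<le> 0" by linarith+
      then show ?thesis by (simp only: ennreal_neg)
    qed (simp only: max_absorb2)
    also have "\<dots> = ennreal (?c * (2 * ?g u))"
      by (simp only: mult_ac)
    also have "\<dots> = ennreal ?c * ennreal (2 * ?g u)"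
      using e by (intro ennreal_mult') auto
    also have "ennreal (2 * ?g u) = emeasure lborel {1 - ?g u..1 + ?g u}"
      by (simp add: emeasure_lborel_Icc_eq ennreal_neg)
    also have "ennreal ?c * \<dots> = (\<integral>\<^sup>+ r. ennreal ?c * indicator {1 - ?g u..1 + ?g u} r \<partial>lborel)"
      by (simp add: nn_integral_cmult_indicator)
    also have "\<dots> \<le> (\<integral>\<^sup>+ r. ennreal (r ^ (DIM('a) - 1)) * indicator {0<..} r * indicator (nbhd \<epsilon>) (r *\<^sub>R u) \<partial>lborel)"
    proof (intro nn_integral_mono)
      fix r :: real
      show "ennreal ?c * indicator {1 - ?g u..1 + ?g u} r
        \<le> ennreal (r ^ (DIM('a) - 1)) * indicator {0<..} r * indicator (nbhd \<epsilon>) (r *\<^sub>R u)"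
      proof (cases "r \<in> {1 - ?g u..1 + ?g u}")
        case True
        then have "\<bar>r - 1\<bar> \<le> \<epsilon> * norm (D u) - 2 * M\<^sup>2 * \<epsilon>\<^sup>2" by auto
        then have "r *\<^sub>R u \<in> nbhd \<epsilon>" using u e by (intro nbhd_inner) auto
        moreover have r: "r \<ge> 1 - M * \<epsilon>" using True g by auto
        then have "?c \<le> r ^ (DIM('a) - 1)" using e Me by (intro power_mono) auto
        moreover have "r > 0" using r e Me by linarith
        ultimately show ?thesis by (auto simp: indicator_def intro!: ennreal_leI)
      qed (auto simp: indicator_def)
    qed
    finally show "ennreal (max 0 (2 * ?c * ?g u))
       \<le> (\<integral>\<^sup>+ r. ennreal (r ^ (DIM('a) - 1)) * indicator {0<..} r * indicator (nbhd \<epsilon>) (r *\<^sub>R u) \<partial>lborel)" .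
  qed
  also have "\<dots> = ennreal (measure lborel (nbhd \<epsilon>))"
    using fin by (simp add: emeasure_eq_ennreal_measure less_top)
  finally show ?thesis by (simp add: ennreal_le_iff)
qed

theorem tendsto_measure_nbhd:
  "((\<lambda>\<epsilon>. measure lborel (nbhd \<epsilon>) / (2 * \<epsilon>)) \<longlongrightarrow> L) (at_right 0)"
proof (rule tendsto_sandwich)
  have ev: "\<forall>\<^sub>F \<epsilon> in at_right 0. \<epsilon> > 0 \<and> 2 * M * \<epsilon> \<le> 1"
    using eventually_at_right_real[of 0 "1 / (2 * M)"] M_pos
    by (auto elim!: eventually_mono simp: field_simps)
  show "\<forall>\<^sub>F \<epsilon> in at_right 0. (1 - 2 * M * \<epsilon>) ^ (DIM('a) - 1) * (L - 2 * M\<^sup>2 * \<epsilon> * measure sphere_measure (sphere (0::'a) 1))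
     \<le> measure lborel (nbhd \<epsilon>) / (2 * \<epsilon>)"
    using ev
  proof (eventually_elim)
    case (elim \<epsilon>)
    then show ?case using measure_nbhd_lower[of \<epsilon>]
      by (simp add: pos_le_divide_eq) (simp add: power2_eq_square algebra_simps)
  qed
  show "\<forall>\<^sub>F \<epsilon> in at_right 0. measure lborel (nbhd \<epsilon>) / (2 * \<epsilon>)
     \<le> (1 + 2 * M * \<epsilon>) ^ (DIM('a) - 1) * (L + 2 * M\<^sup>2 * \<epsilon> * measure sphere_measure (sphere (0::'a) 1))"
    using ev
  proof (eventually_elim)
    case (elim \<epsilon>)
    then show ?case using measure_nbhd_upper[of \<epsilon>]
      by (simp add: pos_divide_le_eq) (simp add: power2_eq_square algebra_simps)
  qed
qed (auto intro!: tendsto_eq_intros)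

end

section \<open>Surface area of ellipsoids\<close>

definition dilate :: "real ^ 'n \<Rightarrow> real ^ 'n \<Rightarrow> real ^ 'n" where
  "dilate q x = (\<chi> i. q $ i * x $ i)"

lemma linear_dilate: "linear (dilate q)"
  by (rule linearI) (simp_all add: dilate_def vec_eq_iff algebra_simps)

lemma inner_dilate: "dilate q x \<bullet> y = x \<bullet> dilate q y"
  by (simp add: dilate_def inner_vec_def mult_ac)

lemma norm_dilate: "norm (dilate q x) = sqrt (\<Sum>i\<in>UNIV. (q $ i)\<^sup>2 * (x $ i)\<^sup>2)"
  by (simp add: dilate_def norm_vec_def L2_set_def power_mult_distrib)

context
  fixes q :: "real ^ 'n"
  assumes q_nz: "\<And>i. q $ i \<noteq> 0"
begin

definition undilate where "undilate = dilate (\<chi> i. inverse (q $ i))"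

lemma dilate_undilate [simp]: "dilate q (undilate x) = x" "undilate (dilate q x) = x"
  using q_nz by (simp_all add: undilate_def dilate_def vec_eq_iff)

lemma image_undilate: "undilate ` X = dilate q -` X"
proof (intro set_eqI iffI)
  fix x assume "x \<in> dilate q -` X"
  then show "x \<in> undilate ` X" by (intro image_eqI[of x _ "dilate q x"]) simp_all
qed auto

lemma linear_undilate: "linear undilate"
  by (simp add: undilate_def linear_dilate)

lemma compact_undilate_image: "compact X \<Longrightarrow> compact (undilate ` X)"
  using linear_undilate
  by (intro compact_continuous_image linear_continuous_on) (simp_all add: linear_conv_bounded_linear)

text \<open>
  Only the existence of the factor is stated, because it cancels in the ratio of area to volume.
\<close>
lemma measure_undilate_image:
  "\<exists>c>0. \<forall>X\<in>sets borel. measure lborel (undilate ` X) = c * measure lborel X"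
proof (intro exI conjI ballI)
  define c where "c j = inverse (q \<bullet> j)" for j
  have undilate_eq: "undilate x = 0 + (\<Sum>j\<in>Basis. (c j * (x \<bullet> j)) *\<^sub>R j)" for x
  proof (rule euclidean_eqI)
    fix b :: "real^'n" assume b: "b \<in> Basis"
    then obtain i where i: "b = axis i 1" by (auto simp: Basis_vec_def)
    show "undilate x \<bullet> b = (0 + (\<Sum>j\<in>Basis. (c j * (x \<bullet> j)) *\<^sub>R j)) \<bullet> b"
      using b by (simp add: inner_sum_left inner_Basis if_distrib cong: if_cong)
        (simp add: i inner_axis undilate_def dilate_def c_def)
  qed
  have c_nz: "c j \<noteq> 0" if "j \<in> Basis" for j
    using that q_nz by (auto simp: Basis_vec_def c_def inner_axis)
  have [measurable]: "undilate \<in> borel_measurable borel" "dilate q \<in> borel_measurable borel"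
    unfolding undilate_def
    by (auto intro!: borel_measurable_continuous_onI linear_continuous_on
          linear_dilate[THEN linear_conv_bounded_linear[THEN iffD1]])
  have lb: "lborel = density (distr lborel borel undilate) (\<lambda>_. ennreal (\<Prod>j\<in>Basis. \<bar>c j\<bar>))"
    using lborel_affine_euclidean[of c 0] c_nz by (simp add: undilate_eq[abs_def])
  show "(\<Prod>j\<in>Basis. \<bar>c j\<bar>) > 0" using c_nz by (intro prod_pos) auto
  fix X :: "(real^'n) set" assume [measurable]: "X \<in> sets borel"
  have "dilate q -` X \<inter> space borel \<in> sets borel" by measurable
  then have [measurable]: "undilate ` X \<in> sets borel" by (simp add: image_undilate)
  have "emeasure lborel (undilate ` X) = ennreal (\<Prod>j\<in>Basis. \<bar>c j\<bar>) * emeasure lborel (undilate -` (undilate ` X))"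
    by (subst lb, subst emeasure_density, simp, simp, subst nn_integral_cmult_indicator, simp, subst emeasure_distr) auto
  also have "undilate -` (undilate ` X) = X"
    by (auto simp: image_undilate)
  finally show "measure lborel (undilate ` X) = (\<Prod>j\<in>Basis. \<bar>c j\<bar>) * measure lborel X"
    by (simp add: measure_def enn2real_mult prod_nonneg)
qed

lemma ellipsoid_eq_image: "ellipsoid q = undilate ` cball 0 1"
  by (auto simp: image_undilate ellipsoid_def norm_dilate)

lemma frontier_ellipsoid: "frontier (ellipsoid q) = undilate ` sphere 0 1"
proof -
  have inj: "inj undilate" by (metis injI dilate_undilate(1))
  have "closure (undilate ` cball 0 1) = undilate ` cball 0 1"
    by (intro closure_closed compact_imp_closed compact_undilate_image) simp
  moreover have "interior (undilate ` cball 0 1) = undilate ` ball 0 1"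
    using interior_injective_linear_image[OF linear_undilate inj, of "cball 0 1"] by simp
  ultimately have "frontier (ellipsoid q) = undilate ` (cball 0 1 - ball 0 1)"
    unfolding frontier_def ellipsoid_eq_image using image_set_diff[OF inj] by simp
  then show ?thesis by (simp add: cball_diff_eq_sphere)
qed

text \<open>
  The tube around the boundary of the ellipsoid is the image of the neighbourhood
  \<open>nbhd \<epsilon>\<close> of the unit sphere, and the ellipsoid is the image of the unit ball under the same linear map.
\<close>
theorem surface_area_ellipsoid_ratio:
  "surface_area (frontier (ellipsoid q)) / measure lborel (ellipsoid q)
   = (\<integral>u. norm (dilate q u) \<partial>sphere_measure) / measure lborel (cball (0::real^'n) 1)"
proof -
  obtain M where M: "M > 0" "\<And>x. norm (dilate q x) \<le> M * norm x"
    using linear_bounded_pos[OF linear_dilate[of q]] by blast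
  interpret selfadjoint_iso "dilate q" undilate M
    by (rule selfadjoint_iso.intro[OF linear_dilate linear_undilate]) (use M in \<open>simp_all add: inner_dilate\<close>)
  obtain c where c: "c > 0" "\<And>X. X \<in> sets borel \<Longrightarrow> measure lborel (undilate ` X) = c * measure lborel X"
    using measure_undilate_image by blast
  have closed: "closed (undilate ` sphere 0 1)"
    by (intro compact_imp_closed compact_undilate_image) simp
  have ne: "undilate ` sphere 0 1 \<noteq> {}"
    by simp
  have tube: "{x. infdist x (undilate ` sphere 0 1) \<le> \<epsilon>} = undilate ` nbhd \<epsilon>" for \<epsilon>
  proof (intro set_eqI iffI)
    fix x assume "x \<in> {x. infdist x (undilate ` sphere 0 1) \<le> \<epsilon>}"
    then have le: "infdist x (undilate ` sphere 0 1) \<le> \<epsilon>" ..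
    obtain w where w: "w \<in> undilate ` sphere 0 1" "infdist x (undilate ` sphere 0 1) = dist x w"
      using infdist_attains_inf[OF closed ne] by blast
    then obtain z where z: "z \<in> sphere 0 1" "w = undilate z" by blast
    have "norm (undilate (dilate q x - z)) = dist x w"
      unfolding z(2) dist_norm linear_diff[OF linear_undilate] dilate_undilate ..
    then have "dilate q x \<in> nbhd \<epsilon>"
      unfolding nbhd_def using z(1) w(2) le by (intro CollectI bexI[of _ z]) simp_all
    then show "x \<in> undilate ` nbhd \<epsilon>"
      by (rule image_eqI[rotated]) simp
  next
    fix x assume "x \<in> undilate ` nbhd \<epsilon>"
    then obtain y z where x: "x = undilate y" "z \<in> sphere 0 1" "norm (undilate (y - z)) \<le> \<epsilon>"
      unfolding nbhd_def by blast
    have "infdist x (undilate ` sphere 0 1) \<le> dist x (undilate z)"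
      using x(2) by (intro infdist_le imageI)
    also have "\<dots> \<le> \<epsilon>"
      using x(3) unfolding x(1) dist_norm linear_diff[OF linear_undilate] .
    finally show "x \<in> {x. infdist x (undilate ` sphere 0 1) \<le> \<epsilon>}" ..
  qed
  have "(\<lambda>\<epsilon>. measure lborel {x. infdist x (frontier (ellipsoid q)) \<le> \<epsilon>} / (2 * \<epsilon>))
      = (\<lambda>\<epsilon>. c * (measure lborel (nbhd \<epsilon>) / (2 * \<epsilon>)))"
  proof
    fix \<epsilon> :: real
    have "measure lborel (undilate ` nbhd \<epsilon>) = c * measure lborel (nbhd \<epsilon>)"
      by (intro c borel_compact compact_nbhd)
    then show "measure lborel {x. infdist x (frontier (ellipsoid q)) \<le> \<epsilon>} / (2 * \<epsilon>)
        = c * (measure lborel (nbhd \<epsilon>) / (2 * \<epsilon>))"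
      by (simp only: frontier_ellipsoid tube times_divide_eq_right)
  qed
  moreover have "((\<lambda>\<epsilon>. c * (measure lborel (nbhd \<epsilon>) / (2 * \<epsilon>))) \<longlongrightarrow> c * L) (at_right 0)"
    by (intro tendsto_mult_left tendsto_measure_nbhd)
  ultimately have "surface_area (frontier (ellipsoid q)) = c * L"
    unfolding surface_area_def by (simp only: tendsto_Lim trivial_limit_at_right_real not_False_eq_True)
  moreover have "measure lborel (ellipsoid q) = c * measure lborel (cball (0::real^'n) 1)"
    unfolding ellipsoid_eq_image by (rule c) simp
  ultimately show ?thesis using c(1) by simp
qed

end

lemma measure_sphere_measure_cball:
  "measure (sphere_measure :: 'a::euclidean_space measure) (sphere 0 1) = real DIM('a) * measure lborel (cball (0::'a) 1)"
proof -
  have "{t *\<^sub>R x |t x. 0 < t \<and> t \<le> 1 \<and> x \<in> sphere (0::'a) 1} = cball 0 1 - {0}"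
  proof (intro set_eqI iffI)
    fix y :: 'a assume "y \<in> cball 0 1 - {0}"
    then have "sgn y \<in> sphere 0 1" "0 < norm y" "norm y \<le> 1" "y = norm y *\<^sub>R sgn y"
      by (auto simp: sgn_div_norm)
    then show "y \<in> {t *\<^sub>R x |t x. 0 < t \<and> t \<le> 1 \<and> x \<in> sphere (0::'a) 1}" by blast
  qed auto
  then have "emeasure (sphere_measure :: 'a measure) (sphere 0 1) = of_nat DIM('a) * emeasure lborel (cball (0::'a) 1 - {0})"
    by (simp add: emeasure_sphere_measure)
  also have "emeasure lborel (cball (0::'a) 1 - {0}) = emeasure lborel (cball (0::'a) 1)"
    by (intro emeasure_Diff_null_set) (auto simp: null_sets_def)
  finally show ?thesis
    by (simp add: measure_def enn2real_mult)
qed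

theorem mainTheorem4:
  fixes q :: "real ^ 'n"
  assumes "CARD('n) \<ge> 2"
    and "\<And>i. q $ i > 0"
  shows "norm_R q = sphere_average (\<lambda>x :: real ^ 'n. sqrt (\<Sum>i\<in>UNIV. (q $ i)\<^sup>2 * (x $ i)\<^sup>2))
    \<and> 3 * Gamma (real CARD('n) / 2) / (2 * Gamma ((real CARD('n) + 1) / 2)) \<ge> norm_R q / norm q
    \<and> norm_R q / norm q \<ge> Gamma (real CARD('n) / 2) / (sqrt pi * Gamma ((real CARD('n) + 1) / 2))"
proof -
  define G where "G = Gamma (real CARD('n) / 2) / Gamma ((real CARD('n) + 1) / 2)"
  define a where "a = sphere_average (\<lambda>x :: real ^ 'n. sqrt (\<Sum>i\<in>UNIV. (q $ i)\<^sup>2 * (x $ i)\<^sup>2))"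
  have nz: "\<And>i. q $ i \<noteq> 0" using assms(2) by (simp add: less_imp_neq[symmetric])
  then have "q \<noteq> 0" by (metis zero_index)
  then have nq: "norm q > 0" by simp
  have "norm_R q = a"
    unfolding norm_R_def a_def sphere_average_def norm_dilate[symmetric]
      surface_area_ellipsoid_ratio[OF nz] measure_sphere_measure_cball
    by simp
  moreover have "a \<le> norm q / sqrt 2 * G" "norm q / sqrt pi * G \<le> a"
    unfolding a_def G_def using ellipsoid_sphere_average_bounds[OF \<open>q \<noteq> 0\<close>] by blast+
  moreover have "norm q / sqrt 2 * G \<le> 3 / 2 * norm q * G"
  proof -
    have "G \<ge> 0" by (simp add: G_def Gamma_real_nonneg)
    have "1 / sqrt 2 \<le> (1 :: real)" by simp
    then have "1 / sqrt 2 \<le> (3 / 2 :: real)" by linarith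
    then have "norm q * (1 / sqrt 2) * G \<le> norm q * (3 / 2) * G"
      using \<open>G \<ge> 0\<close> by (intro mult_right_mono mult_left_mono norm_ge_zero)
    then show ?thesis by (simp add: mult_ac)
  qed
  ultimately have a: "norm_R q = a" "norm_R q \<le> 3 / 2 * norm q * G" "norm q / sqrt pi * G \<le> norm_R q"
    by linarith+
  from a(2) have "norm_R q / norm q \<le> 3 / 2 * G"
    using nq by (simp add: pos_divide_le_eq mult_ac)
  moreover from a(3) have "1 / sqrt pi * G \<le> norm_R q / norm q"
    using nq by (simp add: pos_le_divide_eq mult_ac)
  ultimately show ?thesis using a(1) by (simp add: a_def G_def)
qed

end
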